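(* Let $a$ and $b$ be positive real numbers with $ab<a+b$. Define $P:\mathbb{R}\to\mathbb{R}$ by $$P(t)=F\left(a,b;a+b;\frac{e^t}{1+e^t}\right)F\left(a,b;a+b;\frac{1}{1+e^t}\right).$$ Then: (1) $P$ is even, strictly decreasing on $(-\infty,0]$, and strictly increasing on $[0,\infty)$, and $P''(t)>0$ for all $t$ (so that $P$ is strictly convex on $\mathbb{R}$). Moreover, $P(t)=[|t|+R(a,b)]/B(a,b)+O(te^{-|t|})$ as $t\to+\infty$ or $t\to-\infty$. (2) The derivative $P'$ is odd, strictly increasing on $\mathbb{R}$, with $P'(0)=0$, and $P'(t)=\dfrac{|t|}{t}\cdot\dfrac{1}{B(a,b)}+O(te^{-|t|})$ as $t\to+\infty$ or $t\to-\infty$. In particular, the sharp inequalities $-1/B(a,b)<P'(t)<1/B(a,b)$ hold for all $t\in\mathbb{R}$. (3) The function $P(t)-t/B(a,b)$ is strictly convex and decreasing on $\mathbb{R}$, while $P(t)+t/B(a,b)$ is strictly convex and increasing on $\mathbb{R}$. In particular, the sharp inequality $R(a,b)/B(a,b)<P(t)-|t|/B(a,b)\le P(0)$ holds for all $t\in\mathbb{R}$. (4) The function $G(t)=(P(t)-P(0))/t$ (with $G(0)=P'(0)=0$) is strictly increasing from $\mathbb{R}$ onto $(-1/B(a,b),1/B(a,b))$.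
   Context: $F(a,b;c;x)=\sum_{n=0}^\infty \frac{(a,n)(b,n)}{(c,n)}\frac{x^n}{n!}$ for $|x|<1$ is the Gaussian hypergeometric function, where $(a,0)=1$ and $(a,n)=a(a+1)\cdots(a+n-1)$ for $n\ge1$. $B(a,b)=\Gamma(a)\Gamma(b)/\Gamma(a+b)$ is the beta function, and $R(a,b)=-2\gamma-\Psi(a)-\Psi(b)$, where $\Psi=\Gamma'/\Gamma$ is the digamma function and $\gamma=-\Psi(1)$ is the Euler–Mascheroni constant. "Sharp" means that the constant bounds cannot be improved. *)

theory Defs
  imports "HOL-Analysis.Analysis" "HOL-Library.Landau_Symbols"
begin

definition hyp2F1 :: "real \<Rightarrow> real \<Rightarrow> real \<Rightarrow> real \<Rightarrow> real" where
  "hyp2F1 a b c x =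
     (\<Sum>n. pochhammer a n * pochhammer b n / pochhammer c n * (x ^ n / fact n))"

text \<open>The same series through the library's formal hypergeometric series:\<close>

lemma hyp2F1_conv_eval_fps: "hyp2F1 a b c x = eval_fps (fps_hypergeo [a, b] [c] 1) x"
  by (simp add: hyp2F1_def eval_fps_def fps_hypergeo_nth divide_simps mult_ac)

text \<open>The Ramanujan constant \<open>R(a,b)\<close>; note \<open>Digamma 1 = - euler_mascheroni\<close>.\<close>

definition ramanujan_R :: "real \<Rightarrow> real \<Rightarrow> real" where
  "ramanujan_R a b = - 2 * euler_mascheroni - Digamma a - Digamma b"

definition hyp_prod :: "real \<Rightarrow> real \<Rightarrow> real \<Rightarrow> real" where
  "hyp_prod a b t =
     hyp2F1 a b (a + b) (exp t / (1 + exp t)) * hyp2F1 a b (a + b) (1 / (1 + exp t))"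

definition diff_quot0 :: "(real \<Rightarrow> real) \<Rightarrow> real \<Rightarrow> real" where
  "diff_quot0 f t = (if t = 0 then deriv f 0 else (f t - f 0) / t)"

definition strictly_convex_on :: "real set \<Rightarrow> (real \<Rightarrow> real) \<Rightarrow> bool" where
  "strictly_convex_on S f \<longleftrightarrow> convex S \<and>
     (\<forall>x\<in>S. \<forall>y\<in>S. \<forall>u>0. \<forall>v>0. x \<noteq> y \<and> u + v = 1 \<longrightarrow>
        f (u * x + v * y) < u * f x + v * f y)"

end

theory Submission
  imports Defs "HOL-Real_Asymp.Real_Asymp"
begin

text \<open>
  Write \<open>c = a + b\<close>, \<open>F(x) = F(a,b;c;x) = \<Sum> A\<^sub>n x\<^sup>n\<close>, and \<open>x = e\<^sup>t / (1 + e\<^sup>t)\<close>, so that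
  \<open>dx/dt = x (1 - x)\<close> and \<open>P(t) = F(x) F(1 - x)\<close>.

  The zero-balanced series is special because \<open>(n + 1) A\<^sub>n\<^sub>+\<^sub>1 - n A\<^sub>n = ab A\<^sub>n / (c + n)\<close>
  (\<open>zb_jump_step\<close>). Calling this positive difference \<open>k\<^sub>n\<close>, three facts follow. First,
  \<open>(1 - x) F'(x) = K(x)\<close> with \<open>K(x) = \<Sum> k\<^sub>n x\<^sup>n\<close>, and the definition of \<open>k\<^sub>n\<close> itself reads
  \<open>x K' + c K = ab F\<close>; these two equations replace the hypergeometric differential equation.
  Second, \<open>n A\<^sub>n\<close> increases to its limit, which the product formula for the Gamma function
  identifies as \<open>1 / B(a,b)\<close>, and \<open>\<Sum> k\<^sub>n\<close> telescopes to the same value. Third,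
  \<open>c k\<^sub>n \<le> ab A\<^sub>n\<close>, hence \<open>c K \<le> ab F\<close>.

  In the variable \<open>t\<close>, with \<open>f(t) = F(x)\<close> and \<open>k(t) = K(x)\<close>, the system becomes \<open>f' = x k\<close> and
  \<open>k' = (1 - x) (ab f - c k)\<close>. Put \<open>g(t) = f(- t)\<close> and \<open>l(t) = k(- t)\<close>. Differentiating \<open>P = f g\<close>
  twice gives
  \<open>P'' = x (1 - x) [k g + l f - 2 k l + (ab f - c k) g + (ab g - c l) f]\<close>.
  The last two terms are nonnegative because \<open>c K \<le> ab F\<close>; if \<open>ab < c\<close>, then \<open>K < F\<close> as well, so the
  first three terms have a positive sum. This is where \<open>ab < a + b\<close> enters.

  For the behaviour at infinity, Taylor coefficients of size \<open>O(1/n\<^sup>2)\<close> make a power series approach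
  its value at \<open>1\<close> at the rate \<open>O((1 - x) log (1 / (1 - x)))\<close> (\<open>powser_boundary_estimate\<close>), which is
  \<open>O(t e\<^sup>-\<^sup>t)\<close>. This applies to \<open>K\<close> and to \<open>B F(x) + log (1 - x)\<close>. The value of the latter at \<open>1\<close> is
  \<open>\<Sum> (B A\<^sub>n - 1/n)\<close>, and it equals \<open>R(a,b)\<close> (\<open>zb_const_eq_ramanujan_R\<close>): as a function of \<open>a\<close> the
  sum decreases and drops by \<open>1/a\<close> when \<open>a\<close> grows by one, while the digamma function increases and
  gains \<open>1/a\<close>, which forces their sum to be constant.

  Finally, every assertion of the theorem is true of any even function with positive second
  derivative that has, together with its derivative, these asymptotics; the locale
  \<open>even_convex_asymptote\<close> carries out this part.
\<close>

section \<open>Coefficients of the zero-balanced hypergeometric series\<close>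

definition zb_coeff :: "real \<Rightarrow> real \<Rightarrow> nat \<Rightarrow> real" where
  "zb_coeff a b n = pochhammer a n * pochhammer b n / (pochhammer (a + b) n * fact n)"

text \<open>
  The increment of \<open>n \<mapsto> n A\<^sub>n\<close> by \<open>zb_jump_step\<close>; equivalently the Taylor coefficient of
  \<open>(ab / c) F(a, b; c + 1; x)\<close> with \<open>c = a + b\<close>.
\<close>
definition zb_jump :: "real \<Rightarrow> real \<Rightarrow> nat \<Rightarrow> real" where
  "zb_jump a b n = a * b * zb_coeff a b n / (a + b + n)"

lemma zb_coeff_0 [simp]: "zb_coeff a b 0 = 1"
  by (simp add: zb_coeff_def)

lemma zb_coeff_commute: "zb_coeff a b = zb_coeff b a"
  by (simp add: zb_coeff_def fun_eq_iff mult_ac add_ac)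

lemma zb_coeff_pos: "zb_coeff a b n > 0" if "a > 0" "b > 0"
  using that by (simp add: zb_coeff_def pochhammer_pos)

lemma zb_jump_pos: "zb_jump a b n > 0" if "a > 0" "b > 0"
  using that zb_coeff_pos[OF that] by (simp add: zb_jump_def add_pos_nonneg)

text \<open>
  From \<open>(n + 1) (c + n) A\<^sub>n\<^sub>+\<^sub>1 = (a + n) (b + n) A\<^sub>n\<close>, since \<open>(a + n) (b + n) = n (c + n) + ab\<close> exactly
  when \<open>c = a + b\<close>.
\<close>
lemma zb_jump_step: "real (Suc n) * zb_coeff a b (Suc n) = real n * zb_coeff a b n + zb_jump a b n"
  if "a > 0" "b > 0"
proof -
  define q where "q = pochhammer a n * pochhammer b n / (pochhammer (a + b) n * fact n)"
  have nz: "a + b + real n \<noteq> 0" "pochhammer (a + b) n \<noteq> 0"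
    using that pochhammer_pos[of "a + b" n] by (auto simp: add_pos_nonneg)
  have "real (Suc n) * zb_coeff a b (Suc n) = q * ((a + n) * (b + n) / (a + b + n))"
    using nz by (simp add: zb_coeff_def q_def pochhammer_Suc divide_simps)
  also have "(a + n) * (b + n) / (a + b + n) = n + a * b / (a + b + n)"
    using nz by (simp add: field_simps)
  also have "q * (n + a * b / (a + b + n)) = real n * zb_coeff a b n + zb_jump a b n"
    by (simp add: zb_jump_def zb_coeff_def flip: q_def) (simp add: algebra_simps)
  finally show ?thesis .
qed

lemma Beta_real_pos: "Beta a b > 0" if "a > 0" "b > 0" for a b :: real
  using that by (simp add: Beta_def)

text \<open>
  \<open>(n + 1) A\<^sub>n\<^sub>+\<^sub>1\<close> is a quotient of three partial products of the reciprocal Gamma function, in which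
  the powers of \<open>n\<close> cancel.
\<close>
lemma zb_coeff_limit: "(\<lambda>n. real n * zb_coeff a b n) \<longlonglongrightarrow> 1 / Beta a b"
  if "a > 0" "b > 0"
proof -
  have "(\<lambda>n. rGamma_series a n * rGamma_series b n / rGamma_series (a + b) n)
          \<longlonglongrightarrow> rGamma a * rGamma b / rGamma (a + b)"
    using that by (intro tendsto_intros) (auto simp: rGamma_eq_zero_iff elim!: nonpos_Ints_cases')
  also have "rGamma a * rGamma b / rGamma (a + b) = 1 / Beta a b"
    by (simp add: Beta_def rGamma_inverse_Gamma divide_simps)
  also have "(\<lambda>n. rGamma_series a n * rGamma_series b n / rGamma_series (a + b) n)
     = (\<lambda>n. real (Suc n) * zb_coeff a b (Suc n))"
    by (simp add: fun_eq_iff rGamma_series_def zb_coeff_def distrib_right exp_add del: of_nat_Suc)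
  finally show ?thesis by (subst (asm) filterlim_sequentially_Suc)
qed

lemma zb_coeff_incseq: "incseq (\<lambda>n. real n * zb_coeff a b n)"
  if "a > 0" "b > 0"
  using zb_jump_step[OF that] zb_jump_pos[OF that]
  by (intro incseq_SucI) (simp add: less_imp_le)

lemma zb_coeff_le: "real n * zb_coeff a b n \<le> 1 / Beta a b"
  if "a > 0" "b > 0"
  by (rule incseq_le[OF zb_coeff_incseq[OF that] zb_coeff_limit[OF that]])

text \<open>
  Gauss's evaluation of \<open>F(a, b; a + b + 1; 1)\<close>, obtained here by telescoping.
\<close>
lemma zb_jump_sums: "zb_jump a b sums (1 / Beta a b)"
  if "a > 0" "b > 0"
proof -
  have "(\<lambda>n. real (Suc n) * zb_coeff a b (Suc n) - real n * zb_coeff a b n) sums (1 / Beta a b - real 0 * zb_coeff a b 0)"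
    by (rule telescope_sums[OF zb_coeff_limit[OF that]])
  then show ?thesis using zb_jump_step[OF that] by simp
qed

lemma zb_jump_le: "zb_jump a b n \<le> a * b / Beta a b / real n ^ 2" 
  if "a > 0" "b > 0" "n > 0"
proof -
  have "zb_jump a b n \<le> a * b * zb_coeff a b n / n"
    unfolding zb_jump_def using that zb_coeff_pos[of a b n] by (intro divide_left_mono mult_pos_pos) auto
  also have "\<dots> = a * b * (real n * zb_coeff a b n) / real n ^ 2"
    using that by (simp add: power2_eq_square)
  also have "\<dots> \<le> a * b * (1 / Beta a b) / real n ^ 2"
    using that zb_coeff_le[of a b n] by (intro divide_right_mono mult_left_mono) auto
  finally show ?thesis by simp
qed

text \<open>
  The defect is the tail \<open>\<Sum>\<^bsub>m \<ge> n\<^esub> k\<^sub>m\<close>, and \<open>k\<^sub>m = O(1/m\<^sup>2)\<close>. Rather than summing the tail, adding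
  \<open>C/n\<close> to \<open>n A\<^sub>n\<close> turns this increasing sequence into a decreasing one with the same limit.
\<close>
lemma zb_coeff_limit_defect: "1 / Beta a b - real n * zb_coeff a b n \<le> 2 * (a * b / Beta a b) / real n"
  if "a > 0" "b > 0" "n > 0"
proof -
  define C where "C = 2 * (a * b / Beta a b)"
  have C: "C > 0" using that Beta_real_pos[of a b] by (simp add: C_def)
  define v where "v m = real (Suc m) * zb_coeff a b (Suc m) + C / real (Suc m)" for m
  have "decseq v"
  proof (rule decseq_SucI)
    fix m
    have "v (Suc m) - v m = zb_jump a b (Suc m) - (C / real (Suc m) - C / real (Suc (Suc m)))"
      using zb_jump_step[of a b "Suc m"] that by (simp add: v_def)
    also have "C / real (Suc m) - C / real (Suc (Suc m)) = C / (real (Suc m) * real (Suc (Suc m)))"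
      by (simp add: field_simps)
    \<comment> \<open>Replacing \<open>m + 2\<close> by \<open>2 (m + 1)\<close> accounts for the factor 2 in \<open>C\<close>.\<close>
    also have "\<dots> \<ge> C / (real (Suc m) * (2 * real (Suc m)))"
      using C by (intro divide_left_mono mult_left_mono) auto
    moreover have "zb_jump a b (Suc m) \<le> C / (real (Suc m) * (2 * real (Suc m)))"
      using zb_jump_le[of a b "Suc m"] that by (simp add: C_def power2_eq_square del: of_nat_Suc)
    ultimately show "v (Suc m) \<le> v m" by linarith
  qed
  moreover have "v \<longlonglongrightarrow> 1 / Beta a b + 0"
    unfolding v_def
    by (intro tendsto_add LIMSEQ_Suc[OF zb_coeff_limit] LIMSEQ_Suc[OF lim_const_over_n] that)
  ultimately have "1 / Beta a b \<le> v (n - 1)"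
    using decseq_ge[of v] by auto
  then show ?thesis using that(3) by (simp add: v_def C_def)
qed

lemma zb_coeff_bounded: "zb_coeff a b n \<le> 1 + 1 / Beta a b"
  if "a > 0" "b > 0"
proof (cases "n = 0")
  case False
  then have "zb_coeff a b n \<le> real n * zb_coeff a b n"
    using zb_coeff_pos[OF that, of n] by (simp add: mult_le_cancel_right1)
  then show ?thesis using zb_coeff_le[OF that, of n] by simp
qed (use Beta_real_pos[OF that] in simp)

section \<open>The differential system behind the series\<close>

lemma summable_powser_if_bounded:
  fixes d :: "nat \<Rightarrow> real"
  assumes "\<And>n. \<bar>d n\<bar> \<le> M" "\<bar>x\<bar> < 1"
  shows "summable (\<lambda>n. d n * x ^ n)"
proof (rule summable_comparison_test')
  show "summable (\<lambda>n. M * \<bar>x\<bar> ^ n)" using assms by (intro summable_mult summable_geometric) auto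
  show "norm (d n * x ^ n) \<le> M * \<bar>x\<bar> ^ n" for n
    using assms by (auto simp: abs_mult power_abs intro!: mult_right_mono)
qed

lemma powser_theta_sums:
  fixes d :: "nat \<Rightarrow> real"
  assumes "\<And>n. \<bar>d n\<bar> \<le> M" "\<bar>x\<bar> < 1"
  shows "(\<lambda>n. real n * d n * x ^ n) sums (x * (\<Sum>n. diffs d n * x ^ n))"
    and "((\<lambda>x. \<Sum>n. d n * x ^ n) has_real_derivative (\<Sum>n. diffs d n * x ^ n)) (at x)"
    and "summable (\<lambda>n. diffs d n * x ^ n)"
proof -
  have sm: "norm y < 1 \<Longrightarrow> summable (\<lambda>n. d n * y ^ n)" for y
    using summable_powser_if_bounded[of d M y] assms(1) by simp
  show smd: "summable (\<lambda>n. diffs d n * x ^ n)"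
    by (rule termdiff_converges[OF _ sm]) (use assms in auto)
  show "((\<lambda>x. \<Sum>n. d n * x ^ n) has_real_derivative (\<Sum>n. diffs d n * x ^ n)) (at x)"
    by (rule termdiffs_strong'[OF sm]) (use assms in auto)
  have "(\<lambda>n. x * (real n * d n * x ^ (n - Suc 0))) sums (x * (\<Sum>n. diffs d n * x ^ n))"
    by (intro sums_mult diffs_equiv smd)
  also have "(\<lambda>n. x * (real n * d n * x ^ (n - Suc 0))) = (\<lambda>n. real n * d n * x ^ n)"
  proof
    show "x * (real n * d n * x ^ (n - Suc 0)) = real n * d n * x ^ n" for n
      by (cases n) (auto simp: mult_ac)
  qed
  finally show "(\<lambda>n. real n * d n * x ^ n) sums (x * (\<Sum>n. diffs d n * x ^ n))" .
qed

lemma hyp2F1_zero_balanced: "hyp2F1 a b (a + b) x = (\<Sum>n. zb_coeff a b n * x ^ n)"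
  by (simp add: hyp2F1_def zb_coeff_def)

text \<open>
  The function \<open>(1 - x) F'(x)\<close>. In contrast to \<open>F\<close>, it stays bounded as \<open>x\<close> tends to \<open>1\<close>.
\<close>
definition zb_companion :: "real \<Rightarrow> real \<Rightarrow> real \<Rightarrow> real" where
  "zb_companion a b x = (\<Sum>n. zb_jump a b n * x ^ n)"

lemma zb_coeff_abs_le: "\<bar>zb_coeff a b n\<bar> \<le> 1 + 1 / Beta a b" if "a > 0" "b > 0"
  using zb_coeff_bounded[OF that] zb_coeff_pos[OF that] by (simp add: less_imp_le)

lemma zb_jump_le_coeff: "zb_jump a b n \<le> a * b / (a + b) * zb_coeff a b n" if "a > 0" "b > 0"
proof -
  have "zb_jump a b n \<le> a * b * zb_coeff a b n / (a + b)"
    unfolding zb_jump_def using that zb_coeff_pos[of a b n] 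
    by (intro divide_left_mono mult_pos_pos) (auto intro: add_pos_nonneg)
  then show ?thesis by simp
qed

lemma zb_jump_abs_le: "\<bar>zb_jump a b n\<bar> \<le> a * b / (a + b) * (1 + 1 / Beta a b)" if "a > 0" "b > 0"
proof -
  have "\<bar>zb_jump a b n\<bar> \<le> a * b / (a + b) * zb_coeff a b n"
    using zb_jump_le_coeff[OF that] zb_jump_pos[OF that] by (simp add: less_imp_le)
  also have "\<dots> \<le> a * b / (a + b) * (1 + 1 / Beta a b)"
    using that zb_coeff_bounded[of a b n] by (intro mult_left_mono) auto
  finally show ?thesis .
qed

lemma zb_series_sums:
  assumes "a > 0" "b > 0" "\<bar>x\<bar> < 1"
  shows "(\<lambda>n. zb_coeff a b n * x ^ n) sums hyp2F1 a b (a + b) x"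
    and "(\<lambda>n. zb_jump a b n * x ^ n) sums zb_companion a b x"
  unfolding hyp2F1_zero_balanced zb_companion_def
  by (intro summable_sums summable_powser_if_bounded[OF zb_coeff_abs_le]
      summable_powser_if_bounded[OF zb_jump_abs_le] assms)+

text \<open>
  In \<open>(1 - x) F'(x)\<close> the coefficient of \<open>x\<^sup>n\<close> is \<open>(n + 1) A\<^sub>n\<^sub>+\<^sub>1 - n A\<^sub>n\<close>.
\<close>
lemma hyp2F1_deriv:
  assumes "a > 0" "b > 0" "\<bar>x\<bar> < 1"
  shows "(hyp2F1 a b (a + b) has_real_derivative zb_companion a b x / (1 - x)) (at x)"
proof -
  define D where "D = (\<Sum>n. diffs (zb_coeff a b) n * x ^ n)"
  note th = powser_theta_sums[of "zb_coeff a b", OF zb_coeff_abs_le assms(3), OF assms(1,2)]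
  have "(\<lambda>n. diffs (zb_coeff a b) n * x ^ n - real n * zb_coeff a b n * x ^ n) sums (D - x * D)"
    unfolding D_def by (intro sums_diff summable_sums th)
  moreover have "diffs (zb_coeff a b) n * x ^ n - real n * zb_coeff a b n * x ^ n = zb_jump a b n * x ^ n" for n
    using zb_jump_step[OF assms(1,2), of n] by (simp add: diffs_def algebra_simps)
  ultimately have "D - x * D = zb_companion a b x"
    using zb_series_sums(2)[OF assms] sums_unique2 by force
  then have "D = zb_companion a b x / (1 - x)"
    using assms(3) by (simp add: field_simps)
  then show ?thesis using th(2) by (simp add: D_def hyp2F1_zero_balanced[abs_def])
qed

text \<open>
  Comparing coefficients in \<open>x K' + c K = ab F\<close> gives \<open>(n + c) k\<^sub>n = ab A\<^sub>n\<close>, the definition of \<open>k\<^sub>n\<close>.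
\<close>
lemma zb_companion_deriv:
  assumes "a > 0" "b > 0" "\<bar>x\<bar> < 1" "x \<noteq> 0"
  shows "(zb_companion a b has_real_derivative
           (a * b * hyp2F1 a b (a + b) x - (a + b) * zb_companion a b x) / x) (at x)"
proof -
  define D where "D = (\<Sum>n. diffs (zb_jump a b) n * x ^ n)"
  note th = powser_theta_sums[of "zb_jump a b", OF zb_jump_abs_le assms(3), OF assms(1,2)]
  have "(\<lambda>n. real n * zb_jump a b n * x ^ n + (a + b) * (zb_jump a b n * x ^ n))
          sums (x * D + (a + b) * zb_companion a b x)"
    unfolding D_def by (intro sums_add sums_mult zb_series_sums th assms)
  moreover have "real n * zb_jump a b n * x ^ n + (a + b) * (zb_jump a b n * x ^ n)
      = a * b * (zb_coeff a b n * x ^ n)" for n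
  proof -
    have "(a + b + n) * zb_jump a b n = a * b * zb_coeff a b n"
      using assms by (simp add: zb_jump_def add_pos_nonneg less_imp_neq[symmetric])
    moreover have "real n * zb_jump a b n * x ^ n + (a + b) * (zb_jump a b n * x ^ n)
        = (a + b + n) * zb_jump a b n * x ^ n"
      by (simp add: algebra_simps)
    ultimately show ?thesis by simp
  qed
  moreover have "(\<lambda>n. a * b * (zb_coeff a b n * x ^ n)) sums (a * b * hyp2F1 a b (a + b) x)"
    by (intro sums_mult zb_series_sums assms)
  ultimately have "x * D + (a + b) * zb_companion a b x = a * b * hyp2F1 a b (a + b) x"
    using sums_unique2 by force
  then have "D = (a * b * hyp2F1 a b (a + b) x - (a + b) * zb_companion a b x) / x"
    using assms(4) by (simp add: field_simps)
  then show ?thesis using th(2) by (simp add: D_def zb_companion_def[abs_def])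
qed

section \<open>The Ramanujan constant as a series\<close>

text \<open>
  The Taylor coefficients of \<open>B F(x) + ln (1 - x)\<close>. At \<open>n = 0\<close> the convention \<open>1 / 0 = 0\<close> gives the
  right constant term \<open>B\<close>.
\<close>
definition zb_excess :: "real \<Rightarrow> real \<Rightarrow> nat \<Rightarrow> real" where
  "zb_excess a b n = Beta a b * zb_coeff a b n - 1 / real n"

lemma zb_excess_le: "\<bar>zb_excess a b n\<bar> \<le> 2 * (a * b) / real n ^ 2"
  if "a > 0" "b > 0" "n > 0"
proof -
  have B: "Beta a b > 0" using that by (intro Beta_real_pos)
  have "real n * zb_excess a b n = Beta a b * (real n * zb_coeff a b n - 1 / Beta a b)"
    using that B by (simp add: zb_excess_def algebra_simps)
  moreover have "real n * zb_coeff a b n - 1 / Beta a b \<le> 0"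
    using zb_coeff_le[OF that(1,2), of n] by simp
  moreover have "Beta a b * (real n * zb_coeff a b n - 1 / Beta a b) \<ge> Beta a b * (- (2 * (a * b / Beta a b) / real n))"
    using zb_coeff_limit_defect[OF that] B by (intro mult_left_mono) auto
  ultimately have "\<bar>real n * zb_excess a b n\<bar> \<le> 2 * (a * b) / real n"
    using B by (simp add: mult_nonneg_nonpos)
  then have "real n * \<bar>zb_excess a b n\<bar> \<le> real n * (2 * (a * b) / real n ^ 2)"
    using that by (simp add: abs_mult power2_eq_square)
  then show ?thesis using that by (simp only: mult_le_cancel_left_pos of_nat_0_less_iff)
qed

lemma summable_if_quadratic_bound:
  fixes d :: "nat \<Rightarrow> real"
  assumes "\<And>n. n > 0 \<Longrightarrow> \<bar>d n\<bar> \<le> K / real n ^ 2"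
  shows "summable (\<lambda>n. \<bar>d n\<bar>)"
proof (rule summable_comparison_test'[of _ 1])
  have "summable (\<lambda>n. K * (1 / real n ^ 2))"
    by (intro summable_mult) (use inverse_power_summable[of 2, where 'a = real] in \<open>simp add: inverse_eq_divide\<close>)
  then show "summable (\<lambda>n. K / real n ^ 2)" by simp
qed (use assms in auto)

definition zb_const :: "real \<Rightarrow> real \<Rightarrow> real" where
  "zb_const a b = (\<Sum>n. zb_excess a b n)"

lemma zb_excess_sums: "zb_excess a b sums zb_const a b" if "a > 0" "b > 0"
  unfolding zb_const_def
  using summable_rabs_cancel[OF summable_if_quadratic_bound[OF zb_excess_le[OF that]]]
  by (auto intro: summable_sums)

text \<open>
  This form separates the dependence on \<open>a\<close> into one Gamma quotient, which both the shift
  \<open>a \<mapsto> a + 1\<close> and the monotonicity in \<open>a\<close> exploit.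
\<close>
lemma Beta_zb_coeff_Gamma:
  "Beta a b * zb_coeff a b n = Gamma (a + n) / Gamma (a + n + b) * (Gamma (b + n) / fact n)"
  if "a > 0" "b > 0"
proof -
  have "Gamma a \<noteq> 0" "Gamma b \<noteq> 0" "Gamma (a + b) \<noteq> 0"
    using that by (auto intro!: less_imp_neq[symmetric] Gamma_real_pos)
  moreover have "pochhammer z n = Gamma (z + n) / Gamma z" if "z > 0" for z :: real
    using that by (intro pochhammer_Gamma) (auto elim!: nonpos_Ints_cases')
  ultimately show ?thesis using that by (simp add: Beta_def zb_coeff_def add_ac)
qed

lemma zb_const_commute: "zb_const a b = zb_const b a"
  by (simp add: zb_const_def zb_excess_def[abs_def] zb_coeff_commute[of a b] Beta_commute[of a b])

text \<open>
  The termwise difference between the parameters \<open>a\<close> and \<open>a + 1\<close> is a multiple of \<open>zb_jump a b n\<close>, so it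
  sums up by telescoping.
\<close>
lemma zb_const_plus1: "zb_const (a + 1) b = zb_const a b - 1 / a" if "a > 0" "b > 0"
proof -
  have "Beta a b / a * zb_jump a b n = zb_excess a b n - zb_excess (a + 1) b n" for n
  proof -
    have pos: "a + n > 0" "a + n + b > 0" using that by (auto intro: add_pos_nonneg add_nonneg_pos)
    have "Beta (a + 1) b * zb_coeff (a + 1) b n
        = Gamma (a + n + 1) / Gamma (a + n + b + 1) * (Gamma (b + n) / fact n)"
      using that by (subst Beta_zb_coeff_Gamma) (auto simp: add_ac)
    also have "Gamma (a + n + 1) = (a + n) * Gamma (a + n)"
      using pos by (intro Gamma_plus1) (auto elim!: nonpos_Ints_cases')
    also have "Gamma (a + n + b + 1) = (a + n + b) * Gamma (a + n + b)"
      using pos by (intro Gamma_plus1) (auto elim!: nonpos_Ints_cases')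
    also have "(a + n) * Gamma (a + n) / ((a + n + b) * Gamma (a + n + b)) * (Gamma (b + n) / fact n)
       = (a + n) / (a + n + b) * (Beta a b * zb_coeff a b n)"
      using that by (simp add: Beta_zb_coeff_Gamma)
    finally have "zb_excess a b n - zb_excess (a + 1) b n
       = (1 - (a + n) / (a + n + b)) * (Beta a b * zb_coeff a b n)"
      by (simp add: zb_excess_def algebra_simps)
    also have "1 - (a + n) / (a + n + b) = b / (a + b + n)"
      using pos by (simp add: field_simps)
    finally show ?thesis using that by (simp add: zb_jump_def)
  qed
  moreover have "(\<lambda>n. Beta a b / a * zb_jump a b n) sums (Beta a b / a * (1 / Beta a b))"
    by (intro sums_mult zb_jump_sums that)
  moreover have "(\<lambda>n. zb_excess a b n - zb_excess (a + 1) b n) sums (zb_const a b - zb_const (a + 1) b)"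
    using that by (intro sums_diff zb_excess_sums) auto
  ultimately have "zb_const a b - zb_const (a + 1) b = Beta a b / a * (1 / Beta a b)"
    using sums_unique2 by (metis (no_types, lifting) ext)
  then show ?thesis using Beta_real_pos[OF that] by simp
qed

text \<open>
  The logarithm of the ratio has derivative \<open>Digamma x - Digamma (x + h)\<close>.
\<close>
lemma Gamma_ratio_antimono:
  fixes x y h :: real
  assumes "0 < x" "x \<le> y" "0 < h"
  shows "Gamma y / Gamma (y + h) \<le> Gamma x / Gamma (x + h)"
proof -
  have "ln_Gamma y - ln_Gamma (y + h) \<le> ln_Gamma x - ln_Gamma (x + h)"
  proof (rule DERIV_nonpos_imp_nonincreasing[OF assms(2)], intro exI conjI)
    fix z assume z: "x \<le> z" "z \<le> y"
    show "((\<lambda>x. ln_Gamma x - ln_Gamma (x + h)) has_real_derivative Digamma z - Digamma (z + h)) (at z)"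
      using z assms by (auto intro!: derivative_eq_intros)
    show "Digamma z - Digamma (z + h) \<le> 0"
      using Digamma_real_mono[of z "z + h"] z assms by simp
  qed
  then have "exp (ln_Gamma y - ln_Gamma (y + h)) \<le> exp (ln_Gamma x - ln_Gamma (x + h))" by simp
  then show ?thesis using assms by (simp add: exp_diff Gamma_real_pos_exp)
qed

lemma zb_const_antimono: "zb_const a' b \<le> zb_const a b" if "0 < a" "a \<le> a'" "0 < b"
proof -
  have "Beta a' b * zb_coeff a' b n \<le> Beta a b * zb_coeff a b n" for n
  proof -
    have "Gamma (a' + n) / Gamma (a' + n + b) * (Gamma (b + n) / fact n)
        \<le> Gamma (a + n) / Gamma (a + n + b) * (Gamma (b + n) / fact n)"
      using that by (intro mult_right_mono Gamma_ratio_antimono divide_nonneg_pos Gamma_real_nonneg) auto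
    then show ?thesis using that by (simp only: Beta_zb_coeff_Gamma)
  qed
  then have "zb_excess a' b n \<le> zb_excess a b n" for n by (simp add: zb_excess_def)
  then show ?thesis using that by (intro sums_le[OF _ zb_excess_sums zb_excess_sums]) auto
qed

text \<open>
  A uniqueness argument in the spirit of Bohr and Mollerup. The sum \<open>p + q\<close> has period one, so it can be
  compared far to the right; between consecutive integers \<open>k\<close> and \<open>k + 1\<close> each of the two monotone
  functions moves by at most \<open>1/k\<close>, and in opposite directions.
\<close>
lemma monotone_reciprocal_steps_cancel:
  fixes p q :: "real \<Rightarrow> real"
  assumes p_step: "\<And>x. x > 0 \<Longrightarrow> p (x + 1) = p x + 1 / x"
    and q_step: "\<And>x. x > 0 \<Longrightarrow> q (x + 1) = q x - 1 / x"
    and p_mono: "\<And>x y. 0 < x \<Longrightarrow> x \<le> y \<Longrightarrow> p x \<le> p y"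
    and q_mono: "\<And>x y. 0 < x \<Longrightarrow> x \<le> y \<Longrightarrow> q y \<le> q x"
    and a: "a > 0"
  shows "p a + q a = p 1 + q 1"
proof -
  define s where "s x = p x + q x" for x
  have s_shift: "s (x + real n) = s x" if "x > 0" for x n
  proof (induction n)
    case (Suc n)
    have "s (x + real (Suc n)) = s ((x + real n) + 1)" by (simp add: add_ac)
    also have "\<dots> = s (x + real n)"
      using p_step[of "x + real n"] q_step[of "x + real n"] that by (simp add: s_def add_pos_nonneg)
    finally show ?case using Suc by simp
  qed simp
  have bound: "\<bar>s a - s 1\<bar> \<le> 1 / real (Suc n)" for n
  proof -
    define k where "k = nat \<lfloor>a\<rfloor> + Suc n"
    have k: "real k \<ge> real (Suc n)" "real k \<le> a + Suc n" "a + Suc n \<le> real k + 1"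
      using a by (auto simp: k_def) linarith+
    have kpos: "real k > 0" by (simp add: k_def)
    have "s (real k) = s (1 + real (k - 1))" by (simp add: k_def)
    also have "\<dots> = s 1" by (rule s_shift) simp
    finally have sk: "s (real k) = s 1" .
    have "s a = s (a + Suc n)" using s_shift[OF a, of "Suc n"] by (rule sym)
    moreover have "p (a + Suc n) \<le> p (real k + 1)" "p (real k) \<le> p (a + Suc n)"
      "q (a + Suc n) \<le> q (real k)" "q (real k + 1) \<le> q (a + Suc n)"
      using k kpos a by (auto intro!: p_mono q_mono)
    moreover note p_step[OF kpos] q_step[OF kpos]
    ultimately have "\<bar>s a - s 1\<bar> \<le> 1 / real k" using sk unfolding s_def by linarith
    also have "\<dots> \<le> 1 / real (Suc n)" using k by (intro divide_left_mono) auto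
    finally show ?thesis .
  qed
  have "\<bar>s a - s 1\<bar> \<le> 0"
    by (rule LIMSEQ_le_const[OF LIMSEQ_Suc[OF lim_const_over_n[of 1]]]) (use bound in auto)
  then show ?thesis by (simp add: s_def)
qed

text \<open>
  Here \<open>F(1, 1; 2; x) = - ln (1 - x) / x\<close>, and the sum telescopes. The term at \<open>n = 0\<close> fits in because
  of \<open>1 / 0 = 0\<close>.
\<close>
lemma zb_const_1_1: "zb_const 1 1 = 0"
proof -
  have "pochhammer 2 n = real (Suc n) * fact n" for n
    by (induction n) (simp_all add: pochhammer_Suc algebra_simps)
  moreover have "Gamma (2 :: real) = 1" using Gamma_fact[of 1, where 'a = real] by simp
  ultimately have "zb_excess 1 1 = (\<lambda>n. 1 / real (Suc n) - 1 / real n)"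
    by (simp add: fun_eq_iff zb_excess_def zb_coeff_def Beta_def pochhammer_fact[symmetric] numeral_2_eq_2 del: of_nat_Suc)
  moreover have "(\<lambda>n. 1 / real (Suc n) - 1 / real n) sums (0 - 1 / real 0)"
    by (rule telescope_sums[OF lim_const_over_n])
  ultimately have "zb_excess 1 1 sums 0" by simp
  then show ?thesis using zb_excess_sums[of 1 1] sums_unique2 by force
qed

text \<open>
  By \<open>monotone_reciprocal_steps_cancel\<close>, \<open>zb_const a b + Digamma a\<close> is independent of \<open>a\<close>; by symmetry the
  same holds for \<open>b\<close>, which reduces the claim to \<open>a = b = 1\<close>.
\<close>
theorem zb_const_eq_ramanujan_R: "zb_const a b = ramanujan_R a b" if "a > 0" "b > 0"
proof -
  have *: "Digamma x + zb_const x y = Digamma 1 + zb_const 1 y" if "x > 0" "y > 0" for x y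
    using that
    by (intro monotone_reciprocal_steps_cancel[where p = Digamma and q = "\<lambda>x. zb_const x y"])
       (auto intro: Digamma_plus1 zb_const_plus1 Digamma_real_mono zb_const_antimono)
  show ?thesis
    using *[OF that] *[OF that(2), of 1] zb_const_1_1
    by (simp add: zb_const_commute[of 1 b] ramanujan_R_def)
qed

section \<open>Behaviour of the series near one\<close>

text \<open>
  Termwise, \<open>y \<bar>D'(y)\<bar> \<le> \<Sum> (K / n) y\<^sup>n = - K ln (1 - y)\<close>. Up to the factor that absorbs \<open>y \<ge> 1/2\<close>, this is
  minus the derivative of \<open>W(y) = 2 K (1 - y) (1 - ln (1 - y))\<close>, so \<open>W \<plusminus> D\<close> decreases; letting the right end
  point tend to \<open>1\<close> gives the estimate, as \<open>D\<close> is continuous up to \<open>1\<close>.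
\<close>
lemma powser_boundary_estimate:
  fixes d :: "nat \<Rightarrow> real"
  assumes d: "\<And>n. n > 0 \<Longrightarrow> \<bar>d n\<bar> \<le> K / real n ^ 2" and x: "1/2 \<le> x" "x < 1"
  shows "\<bar>(\<Sum>n. d n) - (\<Sum>n. d n * x ^ n)\<bar> \<le> 2 * K * ((1 - x) * (1 - ln (1 - x)))"
proof -
  define D where "D y = (\<Sum>n. d n * y ^ n)" for y
  define D' where "D' y = (\<Sum>n. diffs d n * y ^ n)" for y
  define W where "W y = 2 * K * ((1 - y) * (1 - ln (1 - y)))" for y
  have K: "K \<ge> 0" using d[of 1] by simp
  have bnd: "\<bar>d n\<bar> \<le> \<bar>d 0\<bar> + K" for n
  proof (cases "n = 0")
    case False
    then have "\<bar>d n\<bar> \<le> K / real n ^ 2" by (intro d) auto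
    also have "\<dots> \<le> K / 1" using False K by (intro divide_left_mono) auto
    finally show ?thesis by simp
  qed (use K in simp)
  note th = powser_theta_sums[of d, OF bnd]
  have deriv_bound: "\<bar>D' y\<bar> \<le> - 2 * K * ln (1 - y)" if y: "1/2 \<le> y" "y < 1" for y
  proof -
    have "(\<lambda>n. - ((- (- y)) ^ n) / of_nat n) sums ln (1 + - y)"
      by (rule ln_series') (use y in auto)
    then have "(\<lambda>n. (- K) * (- (y ^ n) / real n)) sums ((- K) * ln (1 - y))"
      by (intro sums_mult) simp
    then have L: "(\<lambda>n. K / real n * y ^ n) sums (- K * ln (1 - y))" by simp
    have T: "(\<lambda>n. real n * d n * y ^ n) sums (y * D' y)"
      unfolding D'_def by (rule th) (use y in auto)
    have le: "\<bar>real n * d n * y ^ n\<bar> \<le> K / real n * y ^ n" for n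
    proof (cases "n = 0")
      case False
      have "real n * \<bar>d n\<bar> \<le> real n * (K / real n ^ 2)" using False by (intro mult_left_mono d) auto
      also have "\<dots> = K / real n" using False by (simp add: power2_eq_square)
      finally have "real n * \<bar>d n\<bar> * y ^ n \<le> K / real n * y ^ n"
        by (rule mult_right_mono) (use y in simp)
      then show ?thesis using y by (simp add: abs_mult)
    qed simp
    have "y * D' y \<le> - K * ln (1 - y)"
      by (rule sums_le[OF _ T L]) (use le abs_le_D1 in blast)
    moreover have "- (y * D' y) \<le> - K * ln (1 - y)"
      by (rule sums_le[OF _ sums_minus[OF T] L]) (use le abs_le_D2 in blast)
    ultimately have "y * \<bar>D' y\<bar> \<le> - K * ln (1 - y)" using y by (auto simp: abs_if)
    moreover have "1/2 * \<bar>D' y\<bar> \<le> y * \<bar>D' y\<bar>" using y by (intro mult_right_mono) auto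
    ultimately show ?thesis by linarith
  qed
  have step: "\<bar>D y - D x\<bar> \<le> W x" if y: "x \<le> y" "y < 1" for y
  proof -
    have der: "(D has_real_derivative D' z) (at z)" "(W has_real_derivative 2 * K * ln (1 - z)) (at z)"
      if "x \<le> z" "z \<le> y" for z
    proof -
      show "(D has_real_derivative D' z) (at z)"
        unfolding D_def[abs_def] D'_def by (rule th) (use x y that in auto)
      show "(W has_real_derivative 2 * K * ln (1 - z)) (at z)"
      proof -
        have "(W has_real_derivative 2 * K * (- (1 - ln (1 - z)) + (1 - z) * (1 / (1 - z)))) (at z)"
          unfolding W_def[abs_def] using y that by (auto intro!: derivative_eq_intros)
        then show ?thesis using y that by simp
      qed
    qed
    have "W y + D y \<le> W x + D x"
    proof (rule DERIV_nonpos_imp_nonincreasing[OF y(1)], intro exI conjI)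
      fix z assume z: "x \<le> z" "z \<le> y"
      show "((\<lambda>x. W x + D x) has_real_derivative 2 * K * ln (1 - z) + D' z) (at z)"
        using der[OF z] by (auto intro!: derivative_eq_intros)
      show "2 * K * ln (1 - z) + D' z \<le> 0" using deriv_bound[of z] x y z by (auto simp: abs_le_iff)
    qed
    moreover have "W y - D y \<le> W x - D x"
    proof (rule DERIV_nonpos_imp_nonincreasing[OF y(1)], intro exI conjI)
      fix z assume z: "x \<le> z" "z \<le> y"
      show "((\<lambda>x. W x - D x) has_real_derivative 2 * K * ln (1 - z) - D' z) (at z)"
        using der[OF z] by (auto intro!: derivative_eq_intros)
      show "2 * K * ln (1 - z) - D' z \<le> 0" using deriv_bound[of z] x y z by (auto simp: abs_le_iff)
    qed
    moreover have "W y \<ge> 0" unfolding W_def using K x y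
      by (intro mult_nonneg_nonneg) (auto intro: order_trans[of _ 0])
    ultimately show ?thesis by linarith
  qed
  have "continuous_on {0..1} D"
  proof -
    have "uniform_limit {0..1} (\<lambda>n y. \<Sum>i<n. d i * y ^ i) D sequentially"
      unfolding D_def
      by (rule Weierstrass_m_test[where M = "\<lambda>n. \<bar>d n\<bar>"])
        (use summable_if_quadratic_bound[OF d] in
          \<open>auto simp: abs_mult power_abs intro!: mult_left_le power_le_one\<close>)
    then show ?thesis
      by (rule uniform_limit_theorem[rotated]) (auto intro!: always_eventually continuous_intros)
  qed
  then have "(D \<longlongrightarrow> D 1) (at 1 within {0..1})" by (auto simp: continuous_on_def)
  then have "(D \<longlongrightarrow> D 1) (at_left 1)"
    by (rule tendsto_mono[rotated]) (auto simp: at_within_Icc_at_left)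
  then have lim: "((\<lambda>y. \<bar>D y - D x\<bar>) \<longlongrightarrow> \<bar>D 1 - D x\<bar>) (at_left 1)" by (intro tendsto_intros)
  have "eventually (\<lambda>y. y \<in> {x<..<1}) (at_left (1::real))"
    using eventually_at_left_real[of x 1] x by auto
  then have "eventually (\<lambda>y. \<bar>D y - D x\<bar> \<le> W x) (at_left (1::real))"
    by eventually_elim (use step in auto)
  then have "\<bar>D 1 - D x\<bar> \<le> W x" using tendsto_upperbound[OF lim] by auto
  then show ?thesis by (simp add: D_def W_def)
qed

text \<open>
  The boundary estimate for \<open>B F(x) + ln (1 - x)\<close>, whose value at \<open>1\<close> is the Ramanujan constant.
\<close>
lemma hyp2F1_log_asymptotics:
  assumes "a > 0" "b > 0" "1/2 \<le> x" "x < 1"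
  shows "\<bar>hyp2F1 a b (a + b) x - (ramanujan_R a b - ln (1 - x)) / Beta a b\<bar>
           \<le> 4 * (a * b) / Beta a b * ((1 - x) * (1 - ln (1 - x)))"
proof -
  have B: "Beta a b > 0" using assms by (intro Beta_real_pos)
  have "(\<lambda>n. - ((- (- x)) ^ n) / of_nat n) sums ln (1 + - x)"
    by (rule ln_series') (use assms in auto)
  then have "(\<lambda>n. Beta a b * (zb_coeff a b n * x ^ n) + - (x ^ n) / real n)
      sums (Beta a b * hyp2F1 a b (a + b) x + ln (1 - x))"
    by (intro sums_add sums_mult zb_series_sums) (use assms in auto)
  then have "(\<lambda>n. zb_excess a b n * x ^ n) sums (Beta a b * hyp2F1 a b (a + b) x + ln (1 - x))"
    by (simp add: zb_excess_def algebra_simps)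
  then have "(\<Sum>n. zb_excess a b n * x ^ n) = Beta a b * hyp2F1 a b (a + b) x + ln (1 - x)"
    by (rule sums_unique[symmetric])
  moreover have "(\<Sum>n. zb_excess a b n) = ramanujan_R a b"
    using zb_const_eq_ramanujan_R[OF assms(1,2)] by (simp add: zb_const_def)
  ultimately have "\<bar>ramanujan_R a b - (Beta a b * hyp2F1 a b (a + b) x + ln (1 - x))\<bar>
      \<le> 2 * (2 * (a * b)) * ((1 - x) * (1 - ln (1 - x)))"
    using powser_boundary_estimate[OF zb_excess_le[OF assms(1,2)] assms(3,4)] by simp
  moreover have "\<bar>ramanujan_R a b - (Beta a b * hyp2F1 a b (a + b) x + ln (1 - x))\<bar>
      = Beta a b * \<bar>hyp2F1 a b (a + b) x - (ramanujan_R a b - ln (1 - x)) / Beta a b\<bar>"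
    using B by (simp add: abs_mult[symmetric] abs_minus_commute field_simps flip: abs_of_pos)
  ultimately show ?thesis using B by (simp add: field_simps)
qed

lemma zb_companion_asymptotics:
  assumes "a > 0" "b > 0" "1/2 \<le> x" "x < 1"
  shows "\<bar>zb_companion a b x - 1 / Beta a b\<bar>
           \<le> 2 * (a * b / Beta a b) * ((1 - x) * (1 - ln (1 - x)))"
proof -
  have "\<bar>zb_jump a b n\<bar> \<le> a * b / Beta a b / real n ^ 2" if "n > 0" for n
    using zb_jump_le[OF assms(1,2) that] zb_jump_pos[OF assms(1,2), of n] by simp
  from powser_boundary_estimate[OF this assms(3,4)] show ?thesis
    by (simp add: zb_companion_def abs_minus_commute sums_unique[OF zb_jump_sums[OF assms(1,2)], symmetric])
qed

section \<open>The product in the logistic variable\<close>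

definition logistic :: "real \<Rightarrow> real" where
  "logistic t = exp t / (1 + exp t)"

lemma logistic_bounds: "0 < logistic t" "logistic t < 1"
  by (auto simp: logistic_def field_simps add_pos_pos)

lemma logistic_abs_less [simp]: "\<bar>logistic t\<bar> < 1"
  using logistic_bounds[of t] by simp

lemma logistic_uminus: "logistic (- t) = 1 - logistic t"
  by (simp add: logistic_def exp_minus field_simps add_pos_pos add_nonneg_eq_0_iff)

lemma logistic_uminus_exp: "logistic (- t) = 1 / (1 + exp t)"
  by (simp add: logistic_def exp_minus field_simps add_pos_pos add_nonneg_eq_0_iff)

lemma logistic_deriv [derivative_intros]:
  "(logistic has_real_derivative logistic t * (1 - logistic t)) (at t)"
proof -
  have "1 + exp t \<noteq> 0" using exp_gt_zero[of t] by linarith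
  then show ?thesis
    unfolding logistic_def[abs_def]
    by (auto intro!: derivative_eq_intros simp: field_simps)
qed

text \<open>
  Inside this locale \<open>f\<close> and \<open>k\<close> are \<open>F\<close> and its companion in the variable \<open>t\<close>, while \<open>p\<close> and \<open>q\<close> are the
  first and second derivatives of the product \<open>f(t) f(- t)\<close>.
\<close>
locale zero_balanced =
  fixes a b :: real
  assumes a_pos: "a > 0" and b_pos: "b > 0"
begin

definition f :: "real \<Rightarrow> real" where "f t = hyp2F1 a b (a + b) (logistic t)"
definition k :: "real \<Rightarrow> real" where "k t = zb_companion a b (logistic t)"

definition p :: "real \<Rightarrow> real" where
  "p t = logistic t * k t * f (- t) - logistic (- t) * k (- t) * f t"

definition q :: "real \<Rightarrow> real" where
  "q t = logistic t * logistic (- t) *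
     (k t * f (- t) + k (- t) * f t - 2 * k t * k (- t)
      + (a * b * f t - (a + b) * k t) * f (- t) + (a * b * f (- t) - (a + b) * k (- t)) * f t)"

lemma hyp_prod_eq: "hyp_prod a b t = f t * f (- t)"
  by (simp only: hyp_prod_def f_def logistic_uminus_exp logistic_def[of t])

lemma f_deriv: "(f has_real_derivative logistic t * k t) (at t)"
proof -
  have "((\<lambda>t. hyp2F1 a b (a + b) (logistic t)) has_real_derivative
      zb_companion a b (logistic t) / (1 - logistic t) * (logistic t * (1 - logistic t))) (at t)"
    by (rule DERIV_chain2[OF hyp2F1_deriv logistic_deriv]) (use a_pos b_pos in auto)
  then show ?thesis
    using logistic_bounds[of t] by (simp add: f_def[abs_def] k_def mult_ac)
qed

lemma k_deriv: "(k has_real_derivative logistic (- t) * (a * b * f t - (a + b) * k t)) (at t)"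
proof -
  have "((\<lambda>t. zb_companion a b (logistic t)) has_real_derivative
      (a * b * hyp2F1 a b (a + b) (logistic t) - (a + b) * zb_companion a b (logistic t)) / logistic t
        * (logistic t * (1 - logistic t))) (at t)"
    by (rule DERIV_chain2[OF zb_companion_deriv logistic_deriv])
       (use a_pos b_pos logistic_bounds[of t] in auto)
  then show ?thesis
    using logistic_bounds[of t] by (simp add: f_def k_def[abs_def] logistic_uminus mult_ac)
qed

lemma f_minus_deriv: "((\<lambda>t. f (- t)) has_real_derivative - (logistic (- t) * k (- t))) (at t)"
  using DERIV_chain2[OF f_deriv DERIV_minus[OF DERIV_ident], of t] by simp

lemma k_minus_deriv:
  "((\<lambda>t. k (- t)) has_real_derivative - (logistic t * (a * b * f (- t) - (a + b) * k (- t)))) (at t)"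
  using DERIV_chain2[OF k_deriv DERIV_minus[OF DERIV_ident], of t] by simp

lemma hyp_prod_deriv: "(hyp_prod a b has_real_derivative p t) (at t)"
  unfolding hyp_prod_eq[abs_def] p_def
  by (rule DERIV_cong[OF DERIV_mult[OF f_deriv f_minus_deriv]]) (simp add: algebra_simps)

lemma p_deriv: "(p has_real_derivative q t) (at t)"
  unfolding p_def[abs_def] logistic_uminus
  by (rule derivative_eq_intros refl f_deriv k_deriv f_minus_deriv k_minus_deriv)+
     (simp add: q_def logistic_uminus algebra_simps)

text \<open>
  The third inequality holds coefficientwise, because \<open>ab A\<^sub>n = (c + n) k\<^sub>n \<ge> c k\<^sub>n\<close>.
\<close>
lemma f_gt_0: "f t > 0" and k_gt_0: "k t > 0" and k_le_f: "(a + b) * k t \<le> a * b * f t"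
proof -
  note sums = zb_series_sums[OF a_pos b_pos logistic_abs_less[of t]]
  have x: "logistic t > 0" by (rule logistic_bounds)
  show "f t > 0"
    unfolding f_def sums_unique[OF sums(1)]
    by (rule suminf_pos[OF sums_summable[OF sums(1)]]) (use x zb_coeff_pos[OF a_pos b_pos] in auto)
  show "k t > 0"
    unfolding k_def sums_unique[OF sums(2)]
    by (rule suminf_pos[OF sums_summable[OF sums(2)]]) (use x zb_jump_pos[OF a_pos b_pos] in auto)
  have "k t \<le> a * b / (a + b) * f t"
    unfolding k_def f_def
  proof (rule sums_le[OF _ sums(2) sums_mult[OF sums(1)]])
    show "zb_jump a b n * logistic t ^ n \<le> a * b / (a + b) * (zb_coeff a b n * logistic t ^ n)" for n
      using mult_right_mono[OF zb_jump_le_coeff[OF a_pos b_pos, of n], of "logistic t ^ n"] x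
      by (simp add: mult_ac)
  qed
  then show "(a + b) * k t \<le> a * b * f t"
    using a_pos b_pos by (simp add: field_simps)
qed

lemma k_less_f: "k t < f t" if "a * b < a + b"
proof -
  have "(a + b) * k t \<le> a * b * f t" by (rule k_le_f)
  also have "\<dots> < (a + b) * f t" using that f_gt_0 by simp
  finally show ?thesis using a_pos b_pos by simp
qed

text \<open>
  With \<open>k < f\<close> on both sides, \<open>k(t) k(- t)\<close> is below each of \<open>k(t) f(- t)\<close> and \<open>k(- t) f(t)\<close>; the remaining
  terms of \<open>q\<close> are nonnegative by \<open>k_le_f\<close>.
\<close>
lemma q_pos: "q t > 0" if "a * b < a + b"
proof -
  have "k t * k (- t) < k t * f (- t)" "k (- t) * k t < k (- t) * f t"
    using k_less_f[OF that] k_gt_0 by (simp_all add: mult_strict_left_mono)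
  moreover have "(a * b * f t - (a + b) * k t) * f (- t) \<ge> 0"
    "(a * b * f (- t) - (a + b) * k (- t)) * f t \<ge> 0"
    using k_le_f f_gt_0 by (simp_all add: less_imp_le)
  ultimately show ?thesis
    unfolding q_def using logistic_bounds by (intro mult_pos_pos) (auto simp: mult_ac)
qed

text \<open>
  Here \<open>1 - x = 1 / (1 + e\<^sup>t)\<close>, so the boundary error \<open>(1 - x) (1 - ln (1 - x))\<close> is of order \<open>t e\<^sup>-\<^sup>t\<close>, and
  \<open>- ln (1 - x) = ln (1 + e\<^sup>t)\<close> differs from \<open>t\<close> by a smaller amount.
\<close>
lemma f_asymp: "(\<lambda>t. f t - (t + ramanujan_R a b) / Beta a b) \<in> O[at_top](\<lambda>t. t * exp (- t))"
  and k_asymp: "(\<lambda>t. k t - 1 / Beta a b) \<in> O[at_top](\<lambda>t. t * exp (- t))"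
proof -
  have half: "eventually (\<lambda>t. 1/2 \<le> logistic t) at_top"
    using eventually_ge_at_top[of 0] by eventually_elim (simp add: logistic_def field_simps add_pos_pos)
  have compl: "1 - logistic t = 1 / (1 + exp t)" for t
    using logistic_uminus logistic_uminus_exp by metis
  have ln_eq: "ln (1 - logistic t) = - ln (1 + exp t)" for t
    by (simp add: compl ln_div add_pos_pos)
  have "(\<lambda>t. (1 - logistic t) * (1 - ln (1 - logistic t))) = (\<lambda>t. 1 / (1 + exp t) * (1 + ln (1 + exp t)))"
    by (simp only: ln_eq) (simp add: compl)
  also have "\<dots> \<in> O[at_top](\<lambda>t. t * exp (- t))" by real_asymp
  finally have err: "(\<lambda>t. (1 - logistic t) * (1 - ln (1 - logistic t))) \<in> O[at_top](\<lambda>t. t * exp (- t))" .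
  have "(\<lambda>t. f t - (ramanujan_R a b - ln (1 - logistic t)) / Beta a b)
      \<in> O[at_top](\<lambda>t. (1 - logistic t) * (1 - ln (1 - logistic t)))"
  proof (rule bigoI[where c = "4 * (a * b) / Beta a b"], use half in eventually_elim)
    case (elim t)
    let ?e = "(1 - logistic t) * (1 - ln (1 - logistic t))"
    have "\<bar>f t - (ramanujan_R a b - ln (1 - logistic t)) / Beta a b\<bar> \<le> 4 * (a * b) / Beta a b * ?e"
      unfolding f_def by (rule hyp2F1_log_asymptotics[OF a_pos b_pos elim logistic_bounds(2)])
    also have "\<dots> \<le> 4 * (a * b) / Beta a b * norm ?e"
      using Beta_real_pos[OF a_pos b_pos] a_pos b_pos by (intro mult_left_mono) simp_all
    finally show ?case by simp
  qed
  note * = landau_o.big.trans[OF this err]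
  have "(\<lambda>t::real. ln (1 + exp t) - t) \<in> O[at_top](\<lambda>t. t * exp (- t))" by real_asymp
  then have "(\<lambda>t. 1 / Beta a b * (ln (1 + exp t) - t)) \<in> O[at_top](\<lambda>t. t * exp (- t))"
    using Beta_real_pos[OF a_pos b_pos] by (subst landau_o.big.cmult_in_iff) auto
  from sum_in_bigo(1)[OF * this]
  show "(\<lambda>t. f t - (t + ramanujan_R a b) / Beta a b) \<in> O[at_top](\<lambda>t. t * exp (- t))"
    by (simp add: ln_eq add_divide_distrib diff_divide_distrib algebra_simps)
  have "(\<lambda>t. k t - 1 / Beta a b) \<in> O[at_top](\<lambda>t. (1 - logistic t) * (1 - ln (1 - logistic t)))"
  proof (rule bigoI[where c = "2 * (a * b / Beta a b)"], use half in eventually_elim)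
    case (elim t)
    let ?e = "(1 - logistic t) * (1 - ln (1 - logistic t))"
    have "\<bar>k t - 1 / Beta a b\<bar> \<le> 2 * (a * b / Beta a b) * ?e"
      unfolding k_def by (rule zb_companion_asymptotics[OF a_pos b_pos elim logistic_bounds(2)])
    also have "\<dots> \<le> 2 * (a * b / Beta a b) * norm ?e"
      using Beta_real_pos[OF a_pos b_pos] a_pos b_pos by (intro mult_left_mono) simp_all
    finally show ?case by simp
  qed
  from landau_o.big.trans[OF this err]
  show "(\<lambda>t. k t - 1 / Beta a b) \<in> O[at_top](\<lambda>t. t * exp (- t))" .
qed

text \<open>
  \<open>F\<close> is differentiable at \<open>0\<close> with \<open>F(0) = 1\<close>, and its argument is of order \<open>e\<^sup>-\<^sup>t\<close>.
\<close>
lemma f_minus_asymp: "(\<lambda>t. f (- t) - 1) \<in> O[at_top](\<lambda>t. exp (- t))"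
proof -
  have F0: "hyp2F1 a b (a + b) 0 = 1" by (simp add: hyp2F1_zero_balanced)
  have "((\<lambda>h. (hyp2F1 a b (a + b) (0 + h) - hyp2F1 a b (a + b) 0) / h) \<longlongrightarrow> zb_companion a b 0 / (1 - 0)) (at 0)"
    using hyp2F1_deriv[OF a_pos b_pos, of 0] unfolding DERIV_def by simp
  moreover have "filterlim (\<lambda>t. logistic (- t)) (at 0) at_top"
    unfolding logistic_uminus_exp by real_asymp
  ultimately have "((\<lambda>t. (hyp2F1 a b (a + b) (0 + logistic (- t)) - hyp2F1 a b (a + b) 0) / logistic (- t))
      \<longlongrightarrow> zb_companion a b 0 / (1 - 0)) at_top"
    by (rule filterlim_compose)
  then have "(\<lambda>t. f (- t) - 1) \<in> O[at_top](\<lambda>t. logistic (- t))"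
    by (intro bigoI_tendsto) (use logistic_bounds in \<open>auto simp: f_def F0 less_imp_neq[symmetric]\<close>)
  also have "(\<lambda>t. logistic (- t)) \<in> O[at_top](\<lambda>t. exp (- t))"
    unfolding logistic_uminus_exp by real_asymp
  finally show ?thesis .
qed

text \<open>
  The factor \<open>f(- t)\<close> is \<open>1\<close> up to \<open>O(e\<^sup>-\<^sup>t)\<close>, so multiplying the linearly growing \<open>f(t)\<close> by it costs only
  \<open>O(t e\<^sup>-\<^sup>t)\<close>. In \<open>p\<close> the first product tends to \<open>1 / B\<close>, and the second one combines the
  factor \<open>logistic (- t) = O(e\<^sup>-\<^sup>t)\<close> with the linear growth of \<open>f\<close>.
\<close>
lemma hyp_prod_asymp:
  "(\<lambda>t. hyp_prod a b t - (t + ramanujan_R a b) / Beta a b) \<in> O[at_top](\<lambda>t. t * exp (- t))"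
  and p_asymp: "(\<lambda>t. p t - 1 / Beta a b) \<in> O[at_top](\<lambda>t. t * exp (- t))"
proof -
  define L where "L = 1 / Beta a b"
  define R where "R = ramanujan_R a b"
  define E where "E t = t * exp (- t)" for t :: real
  have E1: "(\<lambda>t. exp (- t)) \<in> O[at_top](E)" unfolding E_def by real_asymp
  have Et: "E \<in> O[at_top](\<lambda>t. t)" unfolding E_def by real_asymp
  have f: "(\<lambda>t. f t - (t + R) * L) \<in> O[at_top](E)"
    using f_asymp by (simp add: L_def R_def E_def[abs_def])
  have k: "(\<lambda>t. k t - L) \<in> O[at_top](E)"
    using k_asymp by (simp add: L_def E_def[abs_def])
  have lin: "(\<lambda>t. (t + R) * L) \<in> O[at_top](\<lambda>t. t)" by real_asymp
  have g1: "(\<lambda>t. f (- t) - 1) \<in> O[at_top](\<lambda>_. 1)"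
    by (rule landau_o.big.trans[OF f_minus_asymp]) real_asymp
  have g: "(\<lambda>t. f (- t)) \<in> O[at_top](\<lambda>_. 1)"
    using sum_in_bigo(1)[OF g1, of "\<lambda>_. 1"] by simp
  have fO: "(\<lambda>t. f t) \<in> O[at_top](\<lambda>t. t)"
    using sum_in_bigo(1)[OF landau_o.big.trans[OF f Et] lin] by simp
  have kk: "(\<lambda>t. k (- t)) \<in> O[at_top](\<lambda>_. 1)"
  proof (rule landau_o.big.trans[OF bigoI g])
    show "eventually (\<lambda>t. norm (k (- t)) \<le> a * b / (a + b) * norm (f (- t))) at_top"
    proof (rule always_eventually, rule allI)
      show "norm (k (- t)) \<le> a * b / (a + b) * norm (f (- t))" for t
        using k_le_f[of "- t"] k_gt_0[of "- t"] f_gt_0[of "- t"] a_pos b_pos by (simp add: field_simps)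
    qed
  qed
  have "(\<lambda>t. (f t - (t + R) * L) * f (- t) + ((t + R) * L) * (f (- t) - 1)) \<in> O[at_top](E)"
  proof (rule sum_in_bigo)
    show "(\<lambda>t. (f t - (t + R) * L) * f (- t)) \<in> O[at_top](E)"
      using landau_o.big.mult[OF f g] by simp
    show "(\<lambda>t. ((t + R) * L) * (f (- t) - 1)) \<in> O[at_top](E)"
      using landau_o.big.mult[OF lin f_minus_asymp] by (simp add: E_def[abs_def])
  qed
  moreover have "(f t - (t + R) * L) * f (- t) + ((t + R) * L) * (f (- t) - 1)
      = hyp_prod a b t - (t + R) * L" for t
    by (simp add: hyp_prod_eq algebra_simps)
  ultimately show "(\<lambda>t. hyp_prod a b t - (t + ramanujan_R a b) / Beta a b) \<in> O[at_top](\<lambda>t. t * exp (- t))"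
    by (simp add: L_def R_def E_def[abs_def])
  have s: "logistic \<in> O[at_top](\<lambda>_. 1)" "(\<lambda>t. logistic (- t)) \<in> O[at_top](\<lambda>t. exp (- t))"
    unfolding logistic_uminus_exp logistic_def[abs_def] by real_asymp+
  have "(\<lambda>t. (k t - L) * (logistic t * f (- t)) - L * (logistic (- t) * f (- t)) + L * (f (- t) - 1)
      - logistic (- t) * (k (- t) * f t)) \<in> O[at_top](E)"
  proof (intro sum_in_bigo)
    show "(\<lambda>t. (k t - L) * (logistic t * f (- t))) \<in> O[at_top](E)"
      using landau_o.big.mult[OF k landau_o.big.mult[OF s(1) g]] by simp
    show "(\<lambda>t. L * (logistic (- t) * f (- t))) \<in> O[at_top](E)"
      using landau_o.big.trans[OF landau_o.big.mult[OF s(2) g], of E] E1 by simp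
    show "(\<lambda>t. L * (f (- t) - 1)) \<in> O[at_top](E)"
      using landau_o.big.trans[OF f_minus_asymp E1] by simp
    show "(\<lambda>t. logistic (- t) * (k (- t) * f t)) \<in> O[at_top](E)"
      using landau_o.big.mult[OF s(2) landau_o.big.mult[OF kk fO]] by (simp add: E_def[abs_def] mult.commute)
  qed
  moreover have "(k t - L) * (logistic t * f (- t)) - L * (logistic (- t) * f (- t)) + L * (f (- t) - 1)
      - logistic (- t) * (k (- t) * f t) = p t - L" for t
    by (simp add: p_def logistic_uminus algebra_simps)
  ultimately show "(\<lambda>t. p t - 1 / Beta a b) \<in> O[at_top](\<lambda>t. t * exp (- t))"
    by (simp add: L_def E_def[abs_def])
qed

end

section \<open>Even convex functions with a linear asymptote\<close>

lemma bigo_at_bot_mirror: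
  fixes u v :: "real \<Rightarrow> real"
  assumes "u \<in> O[at_top](v)" "\<And>t. \<bar>u (- t)\<bar> = \<bar>u t\<bar>" "\<And>t. \<bar>v (- t)\<bar> = \<bar>v t\<bar>"
  shows "u \<in> O[at_bot](v)"
proof -
  obtain c where "eventually (\<lambda>t. norm (u t) \<le> c * norm (v t)) at_top"
    using landau_o.bigE[OF assms(1)] by metis
  then have "eventually (\<lambda>t. norm (u t) \<le> c * norm (v t)) at_bot"
    using assms(2,3) by (simp add: at_bot_mirror eventually_filtermap)
  then show ?thesis by (rule bigoI)
qed

lemma bigo_zero_imp_tendsto:
  fixes u v :: "real \<Rightarrow> real"
  assumes "(\<lambda>t. u t - c) \<in> O[F](v)" "v \<in> o[F](\<lambda>_. 1)"
  shows "(u \<longlongrightarrow> c) F"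
proof -
  have "(\<lambda>t. u t - c) \<in> o[F](\<lambda>_. 1)" by (rule landau_o.big_small_trans[OF assms])
  from smalloD_tendsto[OF this] show ?thesis by (simp add: LIM_zero_iff)
qed

text \<open>
  The mean value theorem on both sides of the intermediate point compares the two chord slopes.
\<close>
lemma strictly_convex_on_if_deriv_strict_mono:
  assumes deriv: "\<And>t. (F has_real_derivative F' t) (at t)" and mono: "strict_mono F'"
  shows "strictly_convex_on UNIV F"
proof -
  have *: "F (u * x + v * y) < u * F x + v * F y" if "x < y" "u > 0" "v > 0" "u + v = 1" for x y u v
  proof -
    define z where "z = u * x + v * y"
    have z: "z - x = v * (y - x)" "y - z = u * (y - x)"
      using that(4) unfolding z_def by (auto simp: algebra_simps simp flip: distrib_right)
    moreover have "v * (y - x) > 0" "u * (y - x) > 0" using that by auto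
    ultimately have "x < z" "z < y" by linarith+
    obtain r where r: "x < r" "r < z" "F z - F x = (z - x) * F' r"
      using MVT2[OF \<open>x < z\<close>, of F F'] deriv by auto
    obtain s where s: "z < s" "s < y" "F y - F z = (y - z) * F' s"
      using MVT2[OF \<open>z < y\<close>, of F F'] deriv by auto
    have "F' r < F' s" using mono r s by (auto simp: strict_mono_def)
    then have "u * v * (y - x) * F' r < u * v * (y - x) * F' s"
      using that by (intro mult_strict_left_mono) auto
    then have "u * (F z - F x) < v * (F y - F z)"
      using r s z by (simp add: mult_ac)
    moreover have "u * F z + v * F z = F z" using that(4) by (simp flip: distrib_right)
    ultimately show ?thesis by (simp add: z_def right_diff_distrib)
  qed
  show ?thesis unfolding strictly_convex_on_def
  proof (intro conjI ballI allI impI)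
    fix x y u v :: real assume "u > 0" "v > 0" "x \<noteq> y \<and> u + v = 1"
    then show "F (u * x + v * y) < u * F x + v * F y"
      using *[of x y u v] *[of y x v u] by (cases "x < y") (auto simp: add.commute)
  qed auto
qed

text \<open>
  The analytic input about \<open>P\<close> is reduced to what its graph shows: evenness, positive curvature, and the
  asymptote with slope \<open>1 / B\<close> and intercept \<open>R / B\<close>.
\<close>
locale even_convex_asymptote =
  fixes P p q :: "real \<Rightarrow> real" and B R :: real
  assumes even: "P (- t) = P t"
    and P_deriv: "(P has_real_derivative p t) (at t)"
    and p_deriv: "(p has_real_derivative q t) (at t)"
    and q_pos: "q t > 0"
    and B_pos: "B > 0"
    and P_asymp: "(\<lambda>t. P t - (t + R) / B) \<in> O[at_top](\<lambda>t. t * exp (- t))"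
    and p_asymp: "(\<lambda>t. p t - 1 / B) \<in> O[at_top](\<lambda>t. t * exp (- t))"
begin

lemma deriv_eq: "deriv P = p" "deriv p = q"
  using P_deriv p_deriv by (auto intro!: ext DERIV_imp_deriv)

lemma p_mono: "strict_mono p"
  unfolding strict_mono_def using p_deriv q_pos by (blast intro: DERIV_pos_imp_increasing)

lemma p_odd: "p (- t) = - p t"
proof -
  have "((\<lambda>t. P (- t)) has_real_derivative - p (- t)) (at t)"
    using DERIV_chain2[OF P_deriv DERIV_minus[OF DERIV_ident], of t] by simp
  then have "(P has_real_derivative - p (- t)) (at t)" by (simp add: even)
  from DERIV_unique[OF this P_deriv] show ?thesis by simp
qed

lemma p_0: "p 0 = 0"
  using p_odd[of 0] by simp

lemma error_smallo: "(\<lambda>t::real. t * exp (- t)) \<in> o[at_top](\<lambda>_. 1)"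
  by real_asymp

lemma p_tendsto: "(p \<longlongrightarrow> 1 / B) at_top"
  by (rule bigo_zero_imp_tendsto[OF p_asymp error_smallo])

lemma minus_line_tendsto: "((\<lambda>t. P t - t / B) \<longlongrightarrow> R / B) at_top"
  by (rule bigo_zero_imp_tendsto[OF _ error_smallo])
     (use P_asymp in \<open>simp add: add_divide_distrib algebra_simps\<close>)

lemma p_bounds: "- 1 / B < p t" "p t < 1 / B"
proof -
  have *: "p t < 1 / B" for t
  proof -
    have "p t < p (t + 1)" using p_mono by (simp add: strict_mono_def)
    also have "p (t + 1) \<le> 1 / B"
    proof (rule tendsto_lowerbound[OF p_tendsto])
      show "eventually (\<lambda>s. p (t + 1) \<le> p s) at_top"
        using eventually_ge_at_top[of "t + 1"]
        by eventually_elim (simp add: strict_mono_less_eq[OF p_mono])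
    qed simp
    finally show ?thesis .
  qed
  show "p t < 1 / B" by (rule *)
  show "- 1 / B < p t" using *[of "- t"] by (simp add: p_odd)
qed

lemma p_abs_asymp: "(\<lambda>t. p t - \<bar>t\<bar> / t * (1 / B)) \<in> O[at_top](\<lambda>t. t * exp (- \<bar>t\<bar>))"
proof -
  have ev: "eventually (\<lambda>t::real. t > 0) at_top" by (rule eventually_gt_at_top)
  have 1: "eventually (\<lambda>t. p t - \<bar>t\<bar> / t * (1 / B) = p t - 1 / B) at_top"
    using ev by eventually_elim simp
  have 2: "eventually (\<lambda>t::real. t * exp (- \<bar>t\<bar>) = t * exp (- t)) at_top"
    using ev by eventually_elim simp
  show ?thesis
    using p_asymp by (simp only: landau_o.big.in_cong[OF 1] landau_o.big.cong[OF 2])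
qed

lemma P_abs_asymp: "(\<lambda>t. P t - (\<bar>t\<bar> + R) / B) \<in> O[at_top](\<lambda>t. t * exp (- \<bar>t\<bar>))"
proof -
  have ev: "eventually (\<lambda>t::real. t > 0) at_top" by (rule eventually_gt_at_top)
  have 1: "eventually (\<lambda>t. P t - (\<bar>t\<bar> + R) / B = P t - (t + R) / B) at_top"
    using ev by eventually_elim simp
  have 2: "eventually (\<lambda>t::real. t * exp (- \<bar>t\<bar>) = t * exp (- t)) at_top"
    using ev by eventually_elim simp
  show ?thesis
    using P_asymp by (simp only: landau_o.big.in_cong[OF 1] landau_o.big.cong[OF 2])
qed

lemma convexity_and_asymptote:
  "(\<forall>t. P (- t) = P t) \<and>
   strict_antimono_on {..0} P \<and>
   strict_mono_on {0..} P \<and>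
   (\<forall>t. P differentiable (at t)) \<and>
   (\<forall>t. p differentiable (at t)) \<and>
   (\<forall>t. q t > 0) \<and>
   strictly_convex_on UNIV P \<and>
   (\<lambda>t. P t - (\<bar>t\<bar> + R) / B) \<in> O[at_top](\<lambda>t. t * exp (- \<bar>t\<bar>)) \<and>
   (\<lambda>t. P t - (\<bar>t\<bar> + R) / B) \<in> O[at_bot](\<lambda>t. t * exp (- \<bar>t\<bar>))"
proof (intro conjI allI)
  have incr: "P s < P t" if "0 \<le> s" "s < t" for s t
  proof (rule DERIV_pos_imp_increasing_open[OF that(2)])
    fix x assume "s < x"
    then show "\<exists>y. (P has_real_derivative y) (at x) \<and> 0 < y"
      using P_deriv[of x] p_0 that strict_monoD[OF p_mono, of 0 x] by auto
  qed (auto intro: DERIV_continuous_on P_deriv has_field_derivative_at_within)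
  show "strict_mono_on {0..} P" by (auto simp: monotone_on_def incr)
  show "strict_antimono_on {..0} P"
  proof (rule monotone_onI)
    fix s t :: real assume "s \<in> {..0}" "t \<in> {..0}" "s < t"
    then show "P s > P t" using incr[of "- t" "- s"] by (simp add: even)
  qed
  show "strictly_convex_on UNIV P"
    by (rule strictly_convex_on_if_deriv_strict_mono[OF P_deriv p_mono])
  show "(\<lambda>t. P t - (\<bar>t\<bar> + R) / B) \<in> O[at_bot](\<lambda>t. t * exp (- \<bar>t\<bar>))"
    by (rule bigo_at_bot_mirror[OF P_abs_asymp]) (simp_all add: even)
qed (use even P_deriv p_deriv q_pos P_abs_asymp in \<open>auto simp: real_differentiable_def\<close>)

lemma derivative_bounds:
  "(\<forall>t. p (- t) = - p t) \<and>
   strict_mono p \<and>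
   p 0 = 0 \<and>
   (\<lambda>t. p t - \<bar>t\<bar> / t * (1 / B)) \<in> O[at_top](\<lambda>t. t * exp (- \<bar>t\<bar>)) \<and>
   (\<lambda>t. p t - \<bar>t\<bar> / t * (1 / B)) \<in> O[at_bot](\<lambda>t. t * exp (- \<bar>t\<bar>)) \<and>
   (\<forall>t. - 1 / B < p t \<and> p t < 1 / B) \<and>
   (\<forall>c. (\<forall>t. c \<le> p t) \<longrightarrow> c \<le> - 1 / B) \<and>
   (\<forall>c. (\<forall>t. p t \<le> c) \<longrightarrow> 1 / B \<le> c)"
proof (intro conjI allI impI)
  show "(\<lambda>t. p t - \<bar>t\<bar> / t * (1 / B)) \<in> O[at_bot](\<lambda>t. t * exp (- \<bar>t\<bar>))"
    by (rule bigo_at_bot_mirror[OF p_abs_asymp]) (auto simp: p_odd)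
  have upper: "1 / B \<le> c" if "\<forall>t. p t \<le> c" for c
    by (rule tendsto_upperbound[OF p_tendsto]) (use that in auto)
  show "1 / B \<le> c" if "\<forall>t. p t \<le> c" for c by (rule upper[OF that])
  show "c \<le> - 1 / B" if "\<forall>t. c \<le> p t" for c
  proof -
    have "p t \<le> - c" for t using that[rule_format, of "- t"] by (simp add: p_odd)
    then have "1 / B \<le> - c" by (intro upper) auto
    then show ?thesis by simp
  qed
qed (use p_odd p_mono p_0 p_abs_asymp p_bounds in auto)

text \<open>
  The slope \<open>p\<close> never reaches that of the asymptote, so the gap to the line \<open>t / B\<close> shrinks throughout; the
  bounds on \<open>P t - \<bar>t\<bar> / B\<close> below are its value at \<open>0\<close> and its limit.
\<close>
lemma minus_line_decreasing: "P t - t / B < P s - s / B" if "s < t" for s t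
proof (rule DERIV_neg_imp_decreasing[OF that], intro exI conjI)
  show "((\<lambda>t. P t - t / B) has_real_derivative p x - 1 / B) (at x)" for x
    using P_deriv[of x] B_pos by (auto intro!: derivative_eq_intros)
  show "p x - 1 / B < 0" for x using p_bounds[of x] by simp
qed

lemma minus_and_plus_line:
  "strictly_convex_on UNIV (\<lambda>t. P t - t / B) \<and>
   strict_antimono_on UNIV (\<lambda>t. P t - t / B) \<and>
   strictly_convex_on UNIV (\<lambda>t. P t + t / B) \<and>
   strict_mono (\<lambda>t. P t + t / B) \<and>
   (\<forall>t. R / B < P t - \<bar>t\<bar> / B \<and> P t - \<bar>t\<bar> / B \<le> P 0) \<and>
   (\<forall>c. (\<forall>t. c \<le> P t - \<bar>t\<bar> / B) \<longrightarrow> c \<le> R / B) \<and>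
   (\<forall>c. (\<forall>t. P t - \<bar>t\<bar> / B \<le> c) \<longrightarrow> P 0 \<le> c)"
proof (intro conjI allI impI)
  show "strictly_convex_on UNIV (\<lambda>t. P t - t / B)"
    by (rule strictly_convex_on_if_deriv_strict_mono[where F' = "\<lambda>t. p t - 1 / B"])
       (use P_deriv p_mono B_pos in \<open>auto intro!: derivative_eq_intros simp: strict_mono_def\<close>)
  show "strictly_convex_on UNIV (\<lambda>t. P t + t / B)"
    by (rule strictly_convex_on_if_deriv_strict_mono[where F' = "\<lambda>t. p t + 1 / B"])
       (use P_deriv p_mono B_pos in \<open>auto intro!: derivative_eq_intros simp: strict_mono_def\<close>)
  show "strict_antimono_on UNIV (\<lambda>t. P t - t / B)"
    by (rule monotone_onI) (rule minus_line_decreasing)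
  show "strict_mono (\<lambda>t. P t + t / B)"
    unfolding strict_mono_def using minus_line_decreasing[of "- _" "- _"] by (simp add: even)
  have abs_P: "P t - \<bar>t\<bar> / B = P \<bar>t\<bar> - \<bar>t\<bar> / B" for t by (simp add: abs_if even)
  show "P t - \<bar>t\<bar> / B \<le> P 0" for t
    using minus_line_decreasing[of 0 "\<bar>t\<bar>"] by (cases "t = 0") (auto simp: abs_P[of t])
  show "R / B < P t - \<bar>t\<bar> / B" for t
  proof -
    have "R / B \<le> P (\<bar>t\<bar> + 1) - (\<bar>t\<bar> + 1) / B"
    proof (rule tendsto_upperbound[OF minus_line_tendsto])
      show "eventually (\<lambda>s. P s - s / B \<le> P (\<bar>t\<bar> + 1) - (\<bar>t\<bar> + 1) / B) at_top"
        using eventually_gt_at_top[of "\<bar>t\<bar> + 1"]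
        by eventually_elim (use minus_line_decreasing less_imp_le in blast)
    qed simp
    also have "\<dots> < P \<bar>t\<bar> - \<bar>t\<bar> / B" by (rule minus_line_decreasing) simp
    finally show ?thesis by (simp add: abs_P[of t])
  qed
  show "c \<le> R / B" if c: "\<forall>t. c \<le> P t - \<bar>t\<bar> / B" for c
  proof (rule tendsto_lowerbound[OF minus_line_tendsto])
    show "eventually (\<lambda>t. c \<le> P t - t / B) at_top"
      using eventually_ge_at_top[of 0] by eventually_elim (metis c abs_of_nonneg)
  qed simp
  show "P 0 \<le> c" if "\<forall>t. P t - \<bar>t\<bar> / B \<le> c" for c
    using that[rule_format, of 0] by simp
qed

text \<open>
  By evenness the slope is odd. For \<open>t > 0\<close> it increases by convexity, is some value of \<open>p\<close> by the mean
  value theorem and thus lies in \<open>{0<..<1/B}\<close>, and it tends to \<open>1 / B\<close> because \<open>P\<close> has the asymptote.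
\<close>
lemma slope_from_0:
  "diff_quot0 P 0 = 0 \<and> strict_mono (diff_quot0 P) \<and> range (diff_quot0 P) = {- 1 / B <..< 1 / B}"
proof -
  define G where "G = diff_quot0 P"
  have G0: "G 0 = 0" by (simp add: G_def diff_quot0_def deriv_eq p_0)
  have G: "G t = (P t - P 0) / t" if "t \<noteq> 0" for t using that by (simp add: G_def diff_quot0_def)
  have odd: "G (- t) = - G t" for t
    by (cases "t = 0") (simp_all add: G0 G even)
  have G_mvt: "\<exists>r. 0 < r \<and> r < t \<and> G t = p r" if "t > 0" for t
    using MVT2[OF that, of P p] P_deriv that by (auto simp: G)
  have G_pos: "G t > 0" if "t > 0" for t
    using G_mvt[OF that] strict_monoD[OF p_mono, of 0] p_0 by metis
  have G_less: "G s < G t" if "0 < s" "s < t" for s t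
  proof -
    have sc: "strictly_convex_on UNIV P"
      by (rule strictly_convex_on_if_deriv_strict_mono[OF P_deriv p_mono])
    have "0 < s / t" "0 < 1 - s / t" "s / t + (1 - s / t) = 1" "t \<noteq> 0" using that by auto
    then have "P ((s / t) * t + (1 - s / t) * 0) < (s / t) * P t + (1 - s / t) * P 0"
      using sc unfolding strictly_convex_on_def by blast
    then have "P s - P 0 < s * ((P t - P 0) / t)" using that by (simp add: field_simps)
    then show ?thesis using that by (simp add: G field_simps)
  qed
  have G_nonneg_mono: "G s < G t" if "0 \<le> s" "s < t" for s t
    using that G_less G_pos G0 by (cases "s = 0") auto
  have mono: "strict_mono G"
  proof (rule strict_monoI)
    fix s t :: real assume st: "s < t"
    consider "0 \<le> s" | "t \<le> 0" | "s < 0" "0 < t" by linarith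
    then show "G s < G t"
    proof cases
      case 2
      then show ?thesis using G_nonneg_mono[of "- t" "- s"] st by (simp add: odd)
    next
      case 3
      then show ?thesis using G_pos[of t] G_pos[of "- s"] by (simp add: odd)
    qed (use G_nonneg_mono st in auto)
  qed
  have G_upper: "G t < 1 / B" for t
  proof (cases "t > 0")
    case True
    then show ?thesis using G_mvt[OF True] p_bounds by metis
  next
    case False
    then have "G t \<le> G 0" using strict_mono_less_eq[OF mono] by simp
    also have "G 0 < 1 / B" using B_pos by (simp add: G0)
    finally show ?thesis .
  qed
  have G_lim: "(G \<longlongrightarrow> 1 / B) at_top"
  proof -
    have "((\<lambda>t. (P t - t / B - P 0) * (1 / t) + 1 / B) \<longlongrightarrow> (R / B - P 0) * 0 + 1 / B) at_top"
      by (intro tendsto_intros minus_line_tendsto) real_asymp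
    moreover have "eventually (\<lambda>t. (P t - t / B - P 0) * (1 / t) + 1 / B = G t) at_top"
      using eventually_gt_at_top[of 0] by eventually_elim (use B_pos in \<open>simp add: G field_simps\<close>)
    ultimately show ?thesis using tendsto_cong by force
  qed
  have cont: "isCont G t" for t
  proof (cases "t = 0")
    case True
    have "((\<lambda>t. (P (0 + t) - P 0) / t) \<longlongrightarrow> p 0) (at 0)"
      using P_deriv[of 0] unfolding DERIV_def .
    moreover have "eventually (\<lambda>t. (P (0 + t) - P 0) / t = G t) (at 0)"
      by (auto simp: eventually_at_filter G)
    ultimately show ?thesis using tendsto_cong unfolding isCont_def True G0 p_0 by force
  next
    case False
    have "eventually (\<lambda>s. s \<noteq> 0) (nhds t)"
      using False by (rule t1_space_nhds)
    then have "eventually (\<lambda>s. G s = (P s - P 0) / s) (nhds t)"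
      by eventually_elim (simp add: G)
    moreover have "isCont (\<lambda>s. (P s - P 0) / s) t"
      using False DERIV_isCont[OF P_deriv] by (intro continuous_intros) auto
    ultimately show ?thesis by (subst isCont_cong)
  qed
  have onto: "y \<in> range G" if y: "0 \<le> y" "y < 1 / B" for y
  proof -
    have "eventually (\<lambda>t. y < G t \<and> t > 0) at_top"
      using order_tendstoD(1)[OF G_lim y(2)] eventually_gt_at_top[of 0] by (rule eventually_conj)
    then obtain t where t: "y < G t" "t > 0" by (auto simp: eventually_at_top_linorder)
    have "\<exists>x. 0 \<le> x \<and> x \<le> t \<and> G x = y"
      by (rule IVT) (use t y G0 cont in auto)
    then show ?thesis by blast
  qed
  have "range G = {- 1 / B <..< 1 / B}"
  proof (intro equalityI subsetI)
    fix y assume "y \<in> range G"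
    then obtain t where "y = G t" by blast
    then show "y \<in> {- 1 / B <..< 1 / B}" using G_upper[of t] G_upper[of "- t"] by (simp add: odd)
  next
    fix y assume y: "y \<in> {- 1 / B <..< 1 / B}"
    show "y \<in> range G"
    proof (cases "y \<ge> 0")
      case False
      then obtain t where "- y = G t" using onto[of "- y"] y by auto
      then have "y = G (- t)" by (simp add: odd)
      then show ?thesis by blast
    qed (use onto y in auto)
  qed
  then show ?thesis using G0 mono by (simp add: G_def)
qed

end

section \<open>The product of zero-balanced hypergeometric functions\<close>

theorem theorem3p7:
  fixes a b :: real and P P' G :: "real \<Rightarrow> real" and B R :: real
  assumes "a > 0" and "b > 0" and "a * b < a + b"
  defines "P \<equiv> hyp_prod a b"
    and "P' \<equiv> deriv P"
    and "G \<equiv> diff_quot0 P"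
    and "B \<equiv> Beta a b"
    and "R \<equiv> ramanujan_R a b"
  shows
    "((\<forall>t. P (- t) = P t) \<and>
      strict_antimono_on {..0} P \<and>
      strict_mono_on {0..} P \<and>
      (\<forall>t. P differentiable (at t)) \<and>
      (\<forall>t. P' differentiable (at t)) \<and>
      (\<forall>t. deriv P' t > 0) \<and>
      strictly_convex_on UNIV P \<and>
      (\<lambda>t. P t - (\<bar>t\<bar> + R) / B) \<in> O[at_top](\<lambda>t. t * exp (- \<bar>t\<bar>)) \<and>
      (\<lambda>t. P t - (\<bar>t\<bar> + R) / B) \<in> O[at_bot](\<lambda>t. t * exp (- \<bar>t\<bar>))) \<and>

     ((\<forall>t. P' (- t) = - P' t) \<and>
      strict_mono P' \<and>
      P' 0 = 0 \<and>
      (\<lambda>t. P' t - \<bar>t\<bar> / t * (1 / B)) \<in> O[at_top](\<lambda>t. t * exp (- \<bar>t\<bar>)) \<and>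
      (\<lambda>t. P' t - \<bar>t\<bar> / t * (1 / B)) \<in> O[at_bot](\<lambda>t. t * exp (- \<bar>t\<bar>)) \<and>
      (\<forall>t. - 1 / B < P' t \<and> P' t < 1 / B) \<and>
      (\<forall>c. (\<forall>t. c \<le> P' t) \<longrightarrow> c \<le> - 1 / B) \<and>
      (\<forall>c. (\<forall>t. P' t \<le> c) \<longrightarrow> 1 / B \<le> c)) \<and>

     (strictly_convex_on UNIV (\<lambda>t. P t - t / B) \<and>
      strict_antimono_on UNIV (\<lambda>t. P t - t / B) \<and>
      strictly_convex_on UNIV (\<lambda>t. P t + t / B) \<and>
      strict_mono (\<lambda>t. P t + t / B) \<and>
      (\<forall>t. R / B < P t - \<bar>t\<bar> / B \<and> P t - \<bar>t\<bar> / B \<le> P 0) \<and>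
      (\<forall>c. (\<forall>t. c \<le> P t - \<bar>t\<bar> / B) \<longrightarrow> c \<le> R / B) \<and>
      (\<forall>c. (\<forall>t. P t - \<bar>t\<bar> / B \<le> c) \<longrightarrow> P 0 \<le> c)) \<and>

     (G 0 = 0 \<and>
      strict_mono G \<and>
      range G = {- 1 / B <..< 1 / B})"
proof -
  interpret zero_balanced a b by standard (use assms in auto)
  interpret even_convex_asymptote P p q B R
    unfolding P_def B_def R_def
    by standard
      (use hyp_prod_deriv p_deriv q_pos[OF assms(3)] Beta_real_pos[OF assms(1,2)] hyp_prod_asymp p_asymp
        in \<open>simp_all add: hyp_prod_eq mult.commute\<close>)
  show ?thesis
    unfolding P'_def G_def deriv_eq using convexity_and_asymptote derivative_bounds minus_and_plus_line slope_from_0 by (intro conjI) blast+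
qed

end
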